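(* Let $\Phi:\mathfrak T\to\mathbb R^d$ ($d\ge1$) be an additive functional on patricia tries with toll function $\varphi$. Then the pullback $\widehat\Phi:=\Phi\circ\operatorname{pat}$ is an additive functional on tries, whose toll function $\widehat\varphi$ is given by $$\widehat\varphi(T)=\begin{cases}0&\text{if the root of }T\text{ has exactly one child},\\ \varphi(\operatorname{pat}(T))&\text{otherwise.}\end{cases}$$ That is, for every trie $T$, $\Phi(\operatorname{pat}(T))=\sum_{v\in T}\widehat\varphi(T^v)$.
   Context: $\mathcal A$ is a finite alphabet, $\mathcal A^*=\bigcup_{n\ge0}\mathcal A^n$ the set of finite strings, $\varepsilon$ the empty string. $\mathcal A^*$ is identified with the nodes of the infinite $|\mathcal A|$-ary tree. An $\mathcal A$-ary tree is a prefix-closed subset $T\subset\mathcal A^*$ (the empty tree $\emptyset$ is allowed); $\mathfrak T$ is the set of $\mathcal A$-ary trees and $\bullet:=\{\varepsilon\}$. For $T\subset\mathcal A^*\cup\mathcal A^{\mathbb N}$ and $v\in\mathcal A^*$, $T^v:=\{\alpha:v\alpha\in T\}$ (for a node $v$ of a tree $T$, this is the fringe tree at $v$). For a finite set $\mathfrak X\subseteq\mathcal A^*\cup\mathcal A^{\mathbb N}$ of strings, none a prefix of another, the trie is $T(\emptyset)=\emptyset$, $T(\mathfrak X)=\bullet$ if $|\mathfrak X|=1$, and $T(\mathfrak X)=\{\varepsilon\}\cup\bigcup_{a\in\mathcal A}aT(\mathfrak X^a)$ if $|\mathfrak X|\ge2$. A trie is a tree of the form $T(\mathfrak X)$. The patricia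 trie, regarded as a tree (ignoring stored common prefixes), is $\operatorname{pat}T(\emptyset)=\emptyset$, $\operatorname{pat}T(\mathfrak X)=\bullet$ if $|\mathfrak X|=1$, and $\operatorname{pat}T(\mathfrak X)=\{\varepsilon\}\cup\bigcup_{a}a\operatorname{pat}T(\mathfrak X^{\operatorname{lcp}(\mathfrak X)a})$ if $|\mathfrak X|\ge2$, where $\operatorname{lcp}(\mathfrak X)$ is the longest common prefix. Equivalently, it is obtained from the trie $T=T(\mathfrak X)$ as $\operatorname{pat}(T)$ by iteratively merging every node having exactly one child with that child; so $\operatorname{pat}(T(\mathfrak X))=\operatorname{pat}T(\mathfrak X)$. A toll function is a function $\varphi$ on trees with $\varphi(\emptyset)=0$; the corresponding additive functional is $\Phi(T)=\sum_{v\in T}\varphi(T^v)$. On patricia tries, $\varphi$ and $\Phi$ depend only on the tree structure, not on the stored common prefixes. *)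

theory Defs
  imports "HOL-Analysis.Finite_Cartesian_Product" "HOL-Library.Stream" "HOL-Library.Sublist"
begin

section \<open>Strings and trees\<close>

datatype 'a str = Fin "'a list" | Inf "'a stream"

fun app :: "'a list \<Rightarrow> 'a str \<Rightarrow> 'a str" where
  "app v (Fin u) = Fin (v @ u)"
| "app v (Inf s) = Inf (v @- s)"

fun str_prefix :: "'a str \<Rightarrow> 'a str \<Rightarrow> bool" where
  "str_prefix (Fin u) y \<longleftrightarrow> (\<exists>z. y = app u z)"
| "str_prefix (Inf s) y \<longleftrightarrow> y = Inf s"

definition prefix_free :: "'a str set \<Rightarrow> bool" where
  "prefix_free X \<longleftrightarrow> (\<forall>x\<in>X. \<forall>y\<in>X. x \<noteq> y \<longrightarrow> \<not> str_prefix x y)"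

text \<open>The operation \<open>X\<^sup>v\<close>, once for sets of finite or infinite strings and once for trees.
  A tree is a prefix-closed set of lists. Functions on trees are total functions on sets of
  lists; their values at sets that are not trees never matter.\<close>

definition suffixes_at :: "'a str set \<Rightarrow> 'a list \<Rightarrow> 'a str set" where
  "suffixes_at X v = {x. app v x \<in> X}"

definition fringe :: "'a list set \<Rightarrow> 'a list \<Rightarrow> 'a list set" where
  "fringe T v = {u. v @ u \<in> T}"

definition root_children :: "'a list set \<Rightarrow> 'a set" where
  "root_children T = {a. [a] \<in> T}"

definition common_prefix :: "'a str set \<Rightarrow> 'a list \<Rightarrow> bool" where
  "common_prefix X w \<longleftrightarrow> (\<forall>x\<in>X. str_prefix (Fin w) x)"

text \<open>Only meaningful when \<open>X\<close> has at least two elements, so that the lengths of the common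
  prefixes are bounded.\<close>

definition lcp :: "'a str set \<Rightarrow> 'a list" where
  "lcp X = (ARG_MAX length w. common_prefix X w)"

lemma app_app: "app v (app w x) = app (v @ w) x"
  by (cases x) auto

lemma app_inj: "app v x = app v y \<longleftrightarrow> x = y"
  by (cases x; cases y) (auto simp: shift_left_inj)

lemma app_Nil [simp]: "app [] x = x"
  by (cases x) auto

lemma common_prefix_bounded:
  assumes "x \<noteq> y"
  shows "\<exists>N. \<forall>w. common_prefix {x, y} w \<longrightarrow> length w < N"
proof (cases "\<exists>u. Fin u \<in> {x, y}")
  case True
  then obtain u where u: "Fin u \<in> {x, y}" by blast
  have "length w < Suc (length u)" if w: "common_prefix {x, y} w" for w
  proof -
    obtain z where z: "Fin u = app w z" using w u by (auto simp: common_prefix_def)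
    then show ?thesis by (cases z) auto
  qed
  then show ?thesis by blast
next
  case False
  then obtain s t where st: "x = Inf s" "y = Inf t" by (cases x; cases y) auto
  then have "s \<noteq> t" using assms by auto
  have "\<exists>n. s !! n \<noteq> t !! n"
  proof (rule ccontr)
    assume "\<not> ?thesis"
    then have "smap (\<lambda>n. s !! n) nats = smap (\<lambda>n. t !! n) nats" by simp
    then show False using \<open>s \<noteq> t\<close> by (metis stream_smap_nats)
  qed
  then obtain n where n: "s !! n \<noteq> t !! n" by blast
  have "length w < Suc n" if w: "common_prefix {x, y} w" for w
  proof (rule ccontr)
    assume "\<not> ?thesis"
    then have l: "n < length w" by simp
    obtain p q where pq: "x = app w p" "y = app w q" using w by (auto simp: common_prefix_def)
    obtain p' where p': "s = w @- p'" using pq(1) st by (cases p) auto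
    obtain q' where q': "t = w @- q'" using pq(2) st by (cases q) auto
    show False using n l p' q' by simp
  qed
  then show ?thesis by blast
qed

lemma common_prefix_mono: "common_prefix X w \<Longrightarrow> Y \<subseteq> X \<Longrightarrow> common_prefix Y w"
  by (auto simp: common_prefix_def)

lemma card_ge2_obtain:
  assumes "2 \<le> card X"
  obtains x y where "x \<in> X" "y \<in> X" "x \<noteq> y"
proof -
  have "\<not> is_singleton X" "X \<noteq> {}" using assms by (auto simp: is_singleton_altdef)
  then show ?thesis using that by (meson all_not_in_conv is_singletonI')
qed

lemma lcp_props:
  assumes "2 \<le> card X"
  shows common_prefix_lcp: "common_prefix X (lcp X)"
    and lcp_greatest: "common_prefix X w \<Longrightarrow> length w \<le> length (lcp X)"
proof -
  obtain x y where xy: "x \<in> X" "y \<in> X" "x \<noteq> y" using assms card_ge2_obtain by metis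
  obtain N where N: "\<And>w. common_prefix {x, y} w \<Longrightarrow> length w < N"
    using common_prefix_bounded[OF xy(3)] by blast
  have b: "length w < N" if "common_prefix X w" for w
    by (rule N, rule common_prefix_mono[OF that]) (use xy in simp)
  have c: "common_prefix X []" by (auto simp: common_prefix_def)
  show "common_prefix X (lcp X)"
    unfolding lcp_def using arg_max_natI[of "common_prefix X", OF c] b by (metis less_imp_le)
  show "length w \<le> length (lcp X)" if "common_prefix X w"
    unfolding lcp_def using arg_max_nat_le[of "common_prefix X", OF that] b by (metis less_imp_le)
qed

definition split_bound :: "'a str set \<Rightarrow> nat" where
  "split_bound X = (LEAST N. \<forall>x\<in>X. \<forall>y\<in>X. \<forall>w. x \<noteq> y \<longrightarrow> common_prefix {x, y} w \<longrightarrow> length w < N)"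

lemma split_bound:
  fixes X :: "'a str set"
  assumes "finite X" "x \<in> X" "y \<in> X" "x \<noteq> y" "common_prefix {x, y} w"
  shows "length w < split_bound X"
proof -
  let ?P = "\<lambda>N. \<forall>x\<in>X. \<forall>y\<in>X. \<forall>w. x \<noteq> y \<longrightarrow> common_prefix {x, y} w \<longrightarrow> length w < N"
  obtain N where N: "\<And>(x :: 'a str) y w. x \<noteq> y \<Longrightarrow> common_prefix {x, y} w \<Longrightarrow> length w < N x y"
    using common_prefix_bounded by metis
  have "?P (\<Sum>x\<in>X. \<Sum>y\<in>X. N x y)"
  proof (intro ballI allI impI)
    fix x y w assume a: "x \<in> X" "y \<in> X" "x \<noteq> y" "common_prefix {x, y} w"
    have "length w < N x y" using N a by blast
    also have "\<dots> \<le> (\<Sum>y\<in>X. N x y)" using assms(1) a by (intro member_le_sum) auto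
    also have "\<dots> \<le> (\<Sum>x\<in>X. \<Sum>y\<in>X. N x y)"
      using assms(1) a by (intro member_le_sum[of x X "\<lambda>x. \<Sum>y\<in>X. N x y"]) auto
    finally show "length w < (\<Sum>x\<in>X. \<Sum>y\<in>X. N x y)" .
  qed
  then have "?P (split_bound X)" unfolding split_bound_def by (rule LeastI)
  then show ?thesis using assms by blast
qed

lemma split_bound_suffixes_at:
  assumes "2 \<le> card X"
  shows "split_bound (suffixes_at X [a]) < split_bound X"
proof -
  have fin: "finite X" using assms by (metis card.infinite not_numeral_le_zero)
  obtain x y where "x \<in> X" "y \<in> X" "x \<noteq> y" using assms card_ge2_obtain by metis
  then have pos: "0 < split_bound X" using split_bound[OF fin, of x y "[]"] by (auto simp: common_prefix_def)
  have "split_bound (suffixes_at X [a]) \<le> split_bound X - 1"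
    unfolding split_bound_def[of "suffixes_at X [a]"]
  proof (rule Least_le, intro ballI allI impI)
    fix x y w assume a: "x \<in> suffixes_at X [a]" "y \<in> suffixes_at X [a]" "x \<noteq> y" "common_prefix {x, y} w"
    then have c: "common_prefix {app [a] x, app [a] y} (a # w)"
      by (auto simp: common_prefix_def app_app)
    have "length (a # w) < split_bound X"
      by (rule split_bound[OF fin _ _ _ c]) (use a in \<open>auto simp: suffixes_at_def app_inj\<close>)
    then show "length w < split_bound X - 1" by simp
  qed
  then show ?thesis using pos by simp
qed

lemma card_suffixes_at_lcp:
  assumes "2 \<le> card X"
  shows "card (suffixes_at X (lcp X @ [a])) < card X"
proof -
  let ?v = "lcp X @ [a]" and ?S = "suffixes_at X (lcp X @ [a])"
  have fin: "finite X" using assms by (metis card.infinite not_numeral_le_zero)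
  have "\<not> common_prefix X ?v" using lcp_greatest[OF assms, of ?v] by auto
  then have "app ?v ` ?S \<noteq> X" by (auto simp: common_prefix_def)
  moreover have "app ?v ` ?S \<subseteq> X" by (auto simp: suffixes_at_def)
  ultimately have "card (app ?v ` ?S) < card X" using fin by (simp add: psubset_card_mono psubset_eq)
  moreover have "inj_on (app ?v) ?S" by (auto simp: inj_on_def app_inj)
  ultimately show ?thesis by (simp add: card_image)
qed

section \<open>Tries and patricia tries\<close>

text \<open>Only finite sets are used below, so \<open>card X = 0\<close> means that \<open>X\<close> is empty.\<close>

function trie :: "'a str set \<Rightarrow> 'a list set" where
  "trie X =
    (if card X = 0 then {}
     else if card X = 1 then {[]}
     else {[]} \<union> (\<Union>a. (#) a ` trie (suffixes_at X [a])))"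
  by pat_completeness auto
termination
  by (relation "Wellfounded.measure split_bound") (auto intro!: split_bound_suffixes_at)

function patricia :: "'a str set \<Rightarrow> 'a list set" where
  "patricia X =
    (if card X = 0 then {}
     else if card X = 1 then {[]}
     else {[]} \<union> (\<Union>a. (#) a ` patricia (suffixes_at X (lcp X @ [a]))))"
  by pat_completeness auto
termination
  by (relation "Wellfounded.measure card") (auto intro!: card_suffixes_at_lcp)

declare trie.simps [simp del] patricia.simps [simp del]

definition tries :: "'a list set set" where
  "tries = {trie X |X. finite X \<and> prefix_free X}"

definition patricia_tries :: "'a list set set" where
  "patricia_tries = {patricia X |X. finite X \<and> prefix_free X}"

text \<open>One merging step: a node \<open>v\<close> whose only child is \<open>v @ [a]\<close> is merged with that child,
  so the subtree at \<open>v\<close> is replaced by the subtree at \<open>v @ [a]\<close>.\<close>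

definition merge :: "'a list set \<Rightarrow> 'a list set \<Rightarrow> bool" where
  "merge T T' \<longleftrightarrow> (\<exists>v\<in>T. \<exists>a. root_children (fringe T v) = {a} \<and>
     T' = {u \<in> T. \<not> prefix v u} \<union> (@) v ` fringe T (v @ [a]))"

text \<open>The result of merging until no node has exactly one child. For finite trees it exists and
  does not depend on the order of the merging steps.\<close>

definition pat :: "'a list set \<Rightarrow> 'a list set" where
  "pat T = (THE P. merge\<^sup>*\<^sup>* T P \<and> (\<nexists>P'. merge P P'))"

section \<open>Additive functionals\<close>

text \<open>\<open>\<Phi>\<close> is additive with toll function \<open>\<phi>\<close> on the class \<open>C\<close>. The trees in \<open>C\<close> must be finite,
  as tries and patricia tries over a finite alphabet are.\<close>

definition additive_functional_on ::
  "'a list set set \<Rightarrow> ('a list set \<Rightarrow> 'v::comm_monoid_add) \<Rightarrow> ('a list set \<Rightarrow> 'v) \<Rightarrow> bool" where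
  "additive_functional_on C \<phi> \<Phi> \<longleftrightarrow>
     \<phi> {} = 0 \<and> (\<forall>T\<in>C. \<Phi> T = (\<Sum>v\<in>T. \<phi> (fringe T v)))"

end

(* Merging commutes with taking the subtrees at the children of the root, so every merging step
   leaves the recursively defined contraction unchanged, and normal forms are their own
   contraction; hence pat is the contraction.  The recursion of the contraction turns into the
   recursion of patricia on tries, and the sum over the nodes of a tree, split at the root,
   reproduces the recursion of the contraction: a root with exactly one child contributes 0. *)

theory Submission
  imports Defs
begin

section \<open>Trees as prefix-closed sets, and their decomposition at the root\<close>

section \<open>Prefix-closed sets of lists\<close>

definition prefix_closed :: "'a list set \<Rightarrow> bool" where
  "prefix_closed T \<longleftrightarrow> (\<forall>u v. u @ v \<in> T \<longrightarrow> u \<in> T)"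

lemma prefix_closedD: "prefix_closed T \<Longrightarrow> u @ v \<in> T \<Longrightarrow> u \<in> T"
  unfolding prefix_closed_def by blast

lemma prefix_closed_Nil: "prefix_closed T \<Longrightarrow> T \<noteq> {} \<Longrightarrow> [] \<in> T"
  by (metis append_Nil ex_in_conv prefix_closedD)

lemma prefix_closed_fringe: "prefix_closed T \<Longrightarrow> prefix_closed (fringe T v)"
  unfolding prefix_closed_def fringe_def by (metis append.assoc mem_Collect_eq)

lemma finite_fringe: "finite T \<Longrightarrow> finite (fringe T v)"
  unfolding fringe_def by (rule finite_vimageI[of T "(@) v", unfolded vimage_def]) (auto simp: inj_on_def)

lemma mem_fringe: "u \<in> fringe T v \<longleftrightarrow> v @ u \<in> T"
  by (simp add: fringe_def)

lemma fringe_Nil [simp]: "fringe T [] = T"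
  by (simp add: fringe_def)

lemma fringe_fringe: "fringe (fringe T v) w = fringe T (v @ w)"
  by (simp add: fringe_def)

text \<open>Written with \<open>insert\<close> because this is the form to which the simplifier
  brings \<open>{[]} \<union> S\<close>; it serves the recursions of \<open>trie\<close> and
  \<open>contract\<close> alike.\<close>

lemma fringe_node [simp]: "fringe (insert [] (\<Union>a. (#) a ` S a)) [a] = S a"
  by (auto simp: fringe_def)

lemma tree_split: "[] \<in> T \<Longrightarrow> T = {[]} \<union> (\<Union>a. (#) a ` fringe T [a])"
  by (auto simp: fringe_def image_iff) (metis neq_Nil_conv)

lemma card_fringe_less:
  assumes "finite T" "[] \<in> T"
  shows "card (fringe T [a]) < card T"
proof -
  have "card (fringe T [a]) = card ((#) a ` fringe T [a])"
    by (simp add: card_image)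
  also have "\<dots> < card T"
    by (rule psubset_card_mono) (use assms in \<open>auto simp: fringe_def\<close>)
  finally show ?thesis .
qed

text \<open>A node is the root or lies in the branch of exactly one letter. Letters whose branch is
  empty contribute empty sums, so the outer sum can run over the whole finite alphabet.\<close>

lemma sum_tree:
  fixes f :: "'a::finite list \<Rightarrow> 'b::comm_monoid_add"
  assumes "finite T" "[] \<in> T"
  shows "sum f T = f [] + (\<Sum>a\<in>UNIV. \<Sum>u\<in>fringe T [a]. f (a # u))"
proof -
  have fin: "finite (fringe T [a])" for a
    using assms(1) by (rule finite_fringe)
  have "sum f T = sum f ({[]} \<union> (\<Union>a. (#) a ` fringe T [a]))"
    using tree_split[OF assms(2)] by simp
  also have "\<dots> = f [] + sum f (\<Union>a. (#) a ` fringe T [a])"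
    by (subst sum.union_disjoint) (use fin in auto)
  also have "sum f (\<Union>a. (#) a ` fringe T [a]) = (\<Sum>a\<in>UNIV. sum f ((#) a ` fringe T [a]))"
    by (rule sum.UNION_disjoint) (use fin in auto)
  also have "\<dots> = (\<Sum>a\<in>UNIV. \<Sum>u\<in>fringe T [a]. f (a # u))"
    by (simp add: sum.reindex)
  finally show ?thesis .
qed

section \<open>A recursive form of \<open>pat\<close> that skips unary nodes\<close>

section \<open>Contraction\<close>

text \<open>The value \<open>{}\<close> on infinite sets and on sets without a root is a default
  under which \<open>card\<close> decreases in every recursive call. A leaf falls under the last
  clause, with empty branches.\<close>

function contract :: "'a list set \<Rightarrow> 'a list set" where
  "contract T =
    (if infinite T \<or> [] \<notin> T then {}
     else if card (root_children T) = 1 then contract (fringe T [the_elem (root_children T)])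
     else {[]} \<union> (\<Union>a. (#) a ` contract (fringe T [a])))"
  by pat_completeness auto
termination
  by (relation "Wellfounded.measure card") (auto intro!: card_fringe_less)

declare contract.simps [simp del]

lemma contract_empty [simp]: "contract {} = {}"
  by (simp add: contract.simps)

lemma contract_unary:
  "finite T \<Longrightarrow> [] \<in> T \<Longrightarrow> root_children T = {a} \<Longrightarrow> contract T = contract (fringe T [a])"
  by (subst contract.simps) simp

lemma contract_branching:
  "finite T \<Longrightarrow> [] \<in> T \<Longrightarrow> card (root_children T) \<noteq> 1 \<Longrightarrow>
    contract T = {[]} \<union> (\<Union>a. (#) a ` contract (fringe T [a]))"
  by (subst contract.simps) simp

lemma finite_contract: "finite (contract (T :: 'a::finite list set))"
proof (induction T rule: contract.induct)
  case (1 T)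
  then show ?case by (subst contract.simps) auto
qed

section \<open>Merging steps: invariance, termination and the unique normal form\<close>

section \<open>Merging computes the contraction\<close>

text \<open>Isolates the outcome of a step at a prescribed node and letter, so that induction on the
  node is possible.\<close>

definition merge_at :: "'a list \<Rightarrow> 'a \<Rightarrow> 'a list set \<Rightarrow> 'a list set" where
  "merge_at v a T = {u \<in> T. \<not> prefix v u} \<union> (@) v ` fringe T (v @ [a])"

lemma merge_altdef:
  "merge T T' \<longleftrightarrow> (\<exists>v\<in>T. \<exists>a. root_children (fringe T v) = {a} \<and> T' = merge_at v a T)"
  by (simp add: merge_def merge_at_def)

lemma merge_at_Nil [simp]: "merge_at [] a T = fringe T [a]"
  by (auto simp: merge_at_def)

text \<open>Drives the induction on the merged node: a merge strictly below the root happens inside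
  a single branch.\<close>

lemma fringe_merge_at_Cons:
  "fringe (merge_at (b # w) a T) [c] =
    (if c = b then merge_at w a (fringe T [b]) else fringe T [c])"
  by (auto simp: merge_at_def fringe_def image_iff)

lemma finite_merge_at: "finite T \<Longrightarrow> finite (merge_at v a T)"
  by (simp add: merge_at_def finite_fringe)

text \<open>A node this short either lies outside the subtree at \<open>v\<close> or is
  \<open>v\<close> itself, and \<open>v\<close> reappears as the new position of
  \<open>v @ [a]\<close>.\<close>

lemma mem_merge_at:
  assumes "prefix_closed T" "v @ [a] \<in> T" "u \<in> T" "length u \<le> length v"
  shows "u \<in> merge_at v a T"
proof (cases "prefix v u")
  case True
  then have "u = v" using assms(4) by (auto simp: prefix_def)
  then show ?thesis using assms(2) by (auto simp: merge_at_def fringe_def)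
qed (use assms in \<open>auto simp: merge_at_def\<close>)

lemma prefix_closed_merge_at:
  assumes "prefix_closed T" "v @ [a] \<in> T"
  shows "prefix_closed (merge_at v a T)"
  unfolding prefix_closed_def
proof (intro allI impI)
  fix x y assume xy: "x @ y \<in> merge_at v a T"
  show "x \<in> merge_at v a T"
  proof (cases "prefix v x")
    case True
    then obtain z where z: "x = v @ z" by (auto simp: prefix_def)
    then have "v @ a # z @ y \<in> T"
      using xy by (auto simp: merge_at_def fringe_def)
    then have "v @ a # z \<in> T"
      using prefix_closedD[OF assms(1), of "v @ a # z" y] by simp
    then show ?thesis by (auto simp: z merge_at_def fringe_def)
  next
    case False
    show ?thesis
    proof (cases "prefix v (x @ y)")
      case True
      \<comment> \<open>Here \<open>v\<close> ends inside \<open>y\<close>, so \<open>x\<close> is a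
        proper prefix of \<open>v\<close> and short enough to survive the merge.\<close>
      then have "length x \<le> length v" "prefix x v"
        using False by (auto simp: prefix_append)
      moreover have "v \<in> T" using prefix_closedD[OF assms] .
      ultimately show ?thesis
        using mem_merge_at[OF assms] prefix_closedD[OF assms(1)] by (metis prefix_def)
    next
      case f: False
      then have "x @ y \<in> T" using xy by (auto simp: merge_at_def)
      then show ?thesis using False prefix_closedD[OF assms(1)] by (auto simp: merge_at_def)
    qed
  qed
qed

text \<open>The moved subtree is counted at its old place below \<open>v @ [a]\<close>. There it is
  disjoint from the nodes outside the subtree at \<open>v\<close>, and both together miss
  \<open>v\<close>.\<close>

lemma card_merge_at:
  assumes "finite T" "v \<in> T"
  shows "card (merge_at v a T) < card T"
proof -
  let ?A = "{u \<in> T. \<not> prefix v u}" and ?F = "fringe T (v @ [a])"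
  have fin: "finite ?F" using assms(1) by (rule finite_fringe)
  have "card (merge_at v a T) \<le> card ?A + card ?F"
    unfolding merge_at_def
    by (rule order.trans[OF card_Un_le]) (use fin in \<open>simp add: card_image_le\<close>)
  also have "\<dots> = card ?A + card ((@) (v @ [a]) ` ?F)"
    by (subst card_image) (auto simp: inj_on_def)
  also have "\<dots> = card (?A \<union> (@) (v @ [a]) ` ?F)"
    by (subst card_Un_disjoint) (use assms fin in auto)
  also have "\<dots> < card T"
    by (rule psubset_card_mono) (use assms in \<open>auto simp: fringe_def\<close>)
  finally show ?thesis .
qed

text \<open>A merge at the root is exactly the unary clause of \<open>contract\<close>. A deeper
  merge keeps the children of the root, so the same clause applies before and after, and induction
  handles the affected branch.\<close>

lemma contract_merge_at:
  assumes "finite T" "prefix_closed T" "v \<in> T" "root_children (fringe T v) = {a}"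
  shows "contract (merge_at v a T) = contract T"
  using assms
proof (induction v arbitrary: T)
  case Nil
  then show ?case by (simp add: contract_unary)
next
  case (Cons b w)
  let ?S = "merge_at (b # w) a T"
  have va: "(b # w) @ [a] \<in> T"
    using Cons.prems(4) by (auto simp: root_children_def fringe_def)
  have "[] \<in> T"
    using prefix_closed_Nil[OF Cons.prems(2)] Cons.prems(3) by auto
  then have nil: "[] \<in> T" "[] \<in> ?S"
    using mem_merge_at[OF Cons.prems(2) va, of "[]"] by auto
  have fin: "finite T" "finite ?S"
    using Cons.prems(1) finite_merge_at by auto
  \<comment> \<open>Nodes of length one survive the merge. The only one that moved nodes could
    produce is \<open>[b]\<close>, already in \<open>T\<close> as a prefix of
    \<open>b # w\<close>.\<close>
  have children: "root_children ?S = root_children T"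
    using mem_merge_at[OF Cons.prems(2) va] prefix_closedD[OF Cons.prems(2), of "[b]" w]
      Cons.prems(3) by (auto simp: root_children_def merge_at_def)
  have IH: "contract (merge_at w a (fringe T [b])) = contract (fringe T [b])"
    by (rule Cons.IH)
      (use Cons.prems in \<open>auto simp: finite_fringe prefix_closed_fringe fringe_fringe mem_fringe\<close>)
  have sub: "contract (fringe ?S [c]) = contract (fringe T [c])" for c
    by (simp add: fringe_merge_at_Cons IH)
  show ?case
  proof (cases "card (root_children T) = 1")
    case True
    then obtain c where "root_children T = {c}" by (auto simp: card_1_singleton_iff)
    then show ?thesis using nil fin children sub by (simp add: contract_unary)
  next
    case False
    then show ?thesis using nil fin children sub by (simp add: contract_branching)
  qed
qed

lemma merge_step:
  assumes "merge T T'" "finite T" "prefix_closed T"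
  shows "finite T'" "prefix_closed T'" "card T' < card T" "contract T' = contract T"
proof -
  obtain v a where v: "v \<in> T" "root_children (fringe T v) = {a}" "T' = merge_at v a T"
    using assms(1) by (auto simp: merge_altdef)
  have va: "v @ [a] \<in> T"
    using v(2) by (auto simp: root_children_def fringe_def)
  show "finite T'" "prefix_closed T'" "card T' < card T" "contract T' = contract T"
    unfolding v(3)
    by (rule finite_merge_at[OF assms(2)] prefix_closed_merge_at[OF assms(3) va]
        card_merge_at[OF assms(2) v(1)] contract_merge_at[OF assms(2,3) v(1,2)])+
qed

lemma merge_steps:
  assumes "merge\<^sup>*\<^sup>* T T'" "finite T" "prefix_closed T"
  shows "finite T' \<and> prefix_closed T' \<and> contract T' = contract T"
  using assms by (induction rule: rtranclp_induct) (auto dest: merge_step)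

text \<open>Every merge loses a node, so merging stops.\<close>

lemma merge_normal_form_exists:
  assumes "finite T" "prefix_closed T"
  shows "\<exists>P. merge\<^sup>*\<^sup>* T P \<and> (\<nexists>P'. merge P P')"
  using assms
proof (induction "card T" arbitrary: T rule: less_induct)
  case less
  show ?case
  proof (cases "\<exists>T'. merge T T'")
    case True
    then obtain T' where T': "merge T T'" by blast
    then show ?thesis
      using less.hyps[of T'] merge_step[OF T' less.prems] by (meson converse_rtranclp_into_rtranclp)
  qed auto
qed

lemma contract_normal_form:
  assumes "finite P" "prefix_closed P" "\<nexists>P'. merge P P'"
  shows "contract P = P"
  using assms
proof (induction P rule: contract.induct)
  case (1 P)
  show ?case
  proof (cases "P = {}")
    case False
    then have nil: "[] \<in> P" using prefix_closed_Nil 1 by blast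
    \<comment> \<open>A unary root would allow a merge at \<open>[]\<close>.\<close>
    have c: "card (root_children P) \<noteq> 1"
      using 1 nil unfolding merge_altdef by (metis card_1_singleton_iff One_nat_def fringe_Nil)
    have "contract (fringe P [b]) = fringe P [b]" for b
    proof (rule 1)
      \<comment> \<open>A merge of the branch at \<open>v\<close> would be a merge of
        \<open>P\<close> at \<open>b # v\<close>.\<close>
      show "\<nexists>P'. merge (fringe P [b]) P'"
      proof
        assume "\<exists>P'. merge (fringe P [b]) P'"
        then obtain v a where "v \<in> fringe P [b]" "root_children (fringe (fringe P [b]) v) = {a}"
          by (auto simp: merge_altdef)
        then have "b # v \<in> P" "root_children (fringe P (b # v)) = {a}"
          by (simp_all add: fringe_fringe mem_fringe)
        then show False using 1 unfolding merge_altdef by blast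
      qed
    qed (use 1 nil c in \<open>auto simp: finite_fringe prefix_closed_fringe\<close>)
    then show ?thesis
      using contract_branching[OF 1(3) nil c] tree_split[OF nil] by simp
  qed simp
qed

text \<open>Since \<open>contract\<close> is invariant under merging and fixes normal forms, it pins
  down every reachable normal form; no separate confluence argument is required.\<close>

lemma pat_eq_contract:
  assumes "finite T" "prefix_closed T"
  shows "pat T = contract T"
proof -
  have unique: "P = contract T" if "merge\<^sup>*\<^sup>* T P" "\<nexists>P'. merge P P'" for P
    using merge_steps[OF that(1) assms] contract_normal_form[of P] that(2) by simp
  obtain P where P: "merge\<^sup>*\<^sup>* T P" "\<nexists>P'. merge P P'"
    using merge_normal_form_exists[OF assms] by blast
  show ?thesis
    unfolding pat_def by (rule the_equality) (use P unique[OF P] unique in blast)+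
qed

section \<open>Contracted tries are patricia tries\<close>

lemma app_Cons_eq_iff: "app (a # v) y = app (b # w) z \<longleftrightarrow> a = b \<and> app v y = app w z"
  by (cases y; cases z) auto

lemma app_eq_same_length: "app v y = app w z \<Longrightarrow> length v = length w \<Longrightarrow> v = w"
proof (induction v arbitrary: w)
  case (Cons a v)
  then show ?case by (cases w) (auto simp: app_Cons_eq_iff)
qed simp

lemma app_image_suffixes_at: "app v ` suffixes_at X v = X \<longleftrightarrow> common_prefix X v"
  by (auto simp: suffixes_at_def common_prefix_def)

text \<open>Peels off one letter at a time, matching the recursion of \<open>trie\<close>, whereas
  \<open>patricia\<close> jumps over the whole \<open>lcp\<close>.\<close>

lemma common_prefix_Cons:
  "common_prefix X (a # w) \<longleftrightarrow> common_prefix X [a] \<and> common_prefix (suffixes_at X [a]) w"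
proof
  assume c: "common_prefix X (a # w)"
  have "\<exists>z. x = app [a] z" if x: "x \<in> X" for x
  proof -
    obtain z where "x = app (a # w) z" using c x by (auto simp: common_prefix_def)
    then have "x = app [a] (app w z)" by (simp add: app_app)
    then show ?thesis ..
  qed
  moreover have "\<exists>z. x = app w z" if "app [a] x \<in> X" for x
    using c that by (auto simp: common_prefix_def app_Cons_eq_iff dest!: bspec)
  ultimately show "common_prefix X [a] \<and> common_prefix (suffixes_at X [a]) w"
    by (simp add: common_prefix_def suffixes_at_def)
next
  assume c: "common_prefix X [a] \<and> common_prefix (suffixes_at X [a]) w"
  have "\<exists>z. x = app (a # w) z" if "x \<in> X" for x
  proof -
    obtain y where "x = app [a] y"
      using c \<open>x \<in> X\<close> by (auto simp: common_prefix_def)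
    moreover from this obtain z where "y = app w z"
      using c \<open>x \<in> X\<close> by (auto simp: common_prefix_def suffixes_at_def)
    ultimately show ?thesis by (auto simp: app_app)
  qed
  then show "common_prefix X (a # w)" by (simp add: common_prefix_def)
qed

text \<open>Turns equality of lengths into equality of prefixes. Nonemptiness matters: every list is
  vacuously a common prefix of \<open>{}\<close>.\<close>

lemma common_prefix_unique:
  assumes "common_prefix X v" "common_prefix X w" "length v = length w" "X \<noteq> {}"
  shows "v = w"
proof -
  obtain x where "x \<in> X" using assms(4) by blast
  then obtain y z where "x = app v y" "x = app w z"
    using assms(1,2) unfolding common_prefix_def by (meson str_prefix.simps(1))
  then show ?thesis using app_eq_same_length assms(3) by metis
qed

lemma card_suffixes_at:
  assumes "common_prefix X v"
  shows "card (suffixes_at X v) = card X"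
proof -
  have "card (app v ` suffixes_at X v) = card (suffixes_at X v)"
    by (rule card_image) (simp add: inj_on_def app_inj)
  moreover have "app v ` suffixes_at X v = X"
    using assms by (simp only: app_image_suffixes_at)
  ultimately show ?thesis by simp
qed

lemma suffixes_at_append: "suffixes_at (suffixes_at X v) w = suffixes_at X (v @ w)"
  by (simp add: suffixes_at_def app_app)

lemma finite_suffixes_at: "finite X \<Longrightarrow> finite (suffixes_at X v)"
  unfolding suffixes_at_def
  by (rule finite_vimageI[of X "app v", unfolded vimage_def]) (auto simp: inj_on_def app_inj)

lemma prefix_free_suffixes_at:
  assumes "prefix_free X"
  shows "prefix_free (suffixes_at X v)"
proof -
  have "str_prefix (app v x) (app v y)" if "str_prefix x y" for x y
    using that by (cases x) (auto simp: app_app)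
  then show ?thesis
    using assms unfolding prefix_free_def suffixes_at_def by (metis app_inj mem_Collect_eq)
qed

text \<open>Prepending \<open>a\<close> to the \<open>lcp\<close> of the suffixes gives a common
  prefix of \<open>X\<close>. Conversely the first letter of \<open>lcp X\<close> must be
  \<open>a\<close>, and its tail is common to the suffixes, so the lengths agree.\<close>

lemma lcp_Cons:
  assumes "2 \<le> card X" "common_prefix X [a]"
  shows "lcp X = a # lcp (suffixes_at X [a])"
proof -
  let ?Y = "suffixes_at X [a]"
  have Y: "2 \<le> card ?Y" using assms by (simp add: card_suffixes_at)
  have c: "common_prefix X (a # lcp ?Y)"
    using common_prefix_lcp[OF Y] assms(2) common_prefix_Cons by metis
  have le: "length (a # lcp ?Y) \<le> length (lcp X)"
    by (rule lcp_greatest[OF assms(1) c])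
  then obtain b w where bw: "lcp X = b # w" by (cases "lcp X") auto
  have ne: "X \<noteq> {}" using assms(1) by auto
  have cX: "common_prefix X (b # w)" using common_prefix_lcp[OF assms(1)] bw by simp
  then have "common_prefix X [b]" using common_prefix_Cons by metis
  then have "b = a" using common_prefix_unique[of X "[b]" "[a]"] assms(2) ne by simp
  then have "common_prefix ?Y w" using cX common_prefix_Cons by metis
  then have "length w \<le> length (lcp ?Y)" by (rule lcp_greatest[OF Y])
  then have "length (lcp X) = length (a # lcp ?Y)" using le bw by simp
  then show ?thesis
    using common_prefix_unique[OF common_prefix_lcp[OF assms(1)] c] ne by simp
qed

section \<open>Tries, the children of their roots, and their contraction\<close>

lemma trie_Nil_iff [simp]: "[] \<in> trie X \<longleftrightarrow> card X \<noteq> 0"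
  by (subst trie.simps) auto

lemma fringe_trie: "2 \<le> card X \<Longrightarrow> fringe (trie X) [a] = trie (suffixes_at X [a])"
  by (subst trie.simps) simp

lemma finite_trie: "finite (trie (X :: 'a::finite str set))"
proof (induction X rule: trie.induct)
  case (1 X)
  then show ?case by (subst trie.simps) auto
qed

lemma prefix_closed_trie: "prefix_closed (trie X)"
proof -
  have "u \<in> trie X" if "u @ v \<in> trie X" for u v
    using that
  proof (induction u arbitrary: X)
    case Nil
    then show ?case by (subst (asm) trie.simps) (auto split: if_splits)
  next
    case (Cons a u)
    then have "2 \<le> card X"
      by (subst (asm) trie.simps) (auto split: if_splits)
    then have "w \<in> trie (suffixes_at X [a]) \<longleftrightarrow> a # w \<in> trie X" for w
      using fringe_trie[of X a] by (auto simp: fringe_def)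
    then show ?case using Cons by auto
  qed
  then show ?thesis by (auto simp: prefix_closed_def)
qed

lemma root_children_trie:
  assumes "2 \<le> card X"
  shows "root_children (trie X) = {a. suffixes_at X [a] \<noteq> {}}"
proof -
  have "finite X" using assms by (metis card.infinite not_numeral_le_zero)
  then have "[] \<in> fringe (trie X) [a] \<longleftrightarrow> suffixes_at X [a] \<noteq> {}" for a
    using assms by (simp add: fringe_trie finite_suffixes_at)
  then show ?thesis by (auto simp: root_children_def fringe_def)
qed

text \<open>The empty string is a prefix of every string, so it cannot share a prefix-free set with
  another one.\<close>

lemma prefix_free_first_letter:
  assumes "prefix_free X" "2 \<le> card X" "x \<in> X"
  obtains a y where "x = app [a] y"
proof (cases x)
  case (Fin u)
  show ?thesis
  proof (cases u)
    case Nil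
    have "x = y" if "y \<in> X" for y
      using that assms(1,3) Fin Nil by (auto simp: prefix_free_def)
    then have False using card_ge2_obtain[OF assms(2)] by metis
    then show ?thesis ..
  next
    case (Cons a w)
    then show ?thesis using that[of a "Fin w"] Fin by simp
  qed
next
  case (Inf s)
  then show ?thesis using that[of "shd s" "Inf (stl s)"] by simp
qed

text \<open>Links the two constructions: contraction is steered by unary roots,
  \<open>patricia\<close> by common prefixes.\<close>

lemma root_children_trie_singleton_iff:
  assumes "prefix_free X" "2 \<le> card X"
  shows "root_children (trie X) = {a} \<longleftrightarrow> common_prefix X [a]" (is "?L \<longleftrightarrow> ?R")
proof
  assume ?L
  then have c: "b = a" if "suffixes_at X [b] \<noteq> {}" for b
    using that root_children_trie[OF assms(2)] by auto
  have "\<exists>y. x = app [a] y" if x: "x \<in> X" for x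
  proof -
    obtain b y where y: "x = app [b] y" using prefix_free_first_letter[OF assms x] .
    then have "y \<in> suffixes_at X [b]" using x by (simp add: suffixes_at_def)
    then show ?thesis using c y by blast
  qed
  then show ?R by (simp add: common_prefix_def)
next
  assume R: ?R
  have "b = a" if b: "suffixes_at X [b] \<noteq> {}" for b
  proof -
    obtain y where "app [b] y \<in> X" using b by (auto simp: suffixes_at_def)
    then obtain z where "app [b] y = app [a] z" using R by (auto simp: common_prefix_def)
    then show ?thesis by (simp add: app_Cons_eq_iff)
  qed
  moreover have "suffixes_at X [a] \<noteq> {}"
    using card_suffixes_at[OF R] assms(2) by auto
  ultimately show ?L unfolding root_children_trie[OF assms(2)] by blast
qed

text \<open>Induction follows \<open>trie\<close>. At a unary root, dropping the common first letter
  does not change the patricia trie; at a branching root \<open>lcp X\<close> is empty and both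
  recursions coincide.\<close>

lemma contract_trie:
  fixes X :: "'a::finite str set"
  assumes "finite X" "prefix_free X"
  shows "contract (trie X) = patricia X"
  using assms
proof (induction X rule: trie.induct)
  case (1 X)
  consider (zero) "card X = 0" | (one) "card X = 1" | (many) "2 \<le> card X" by linarith
  then show ?case
  proof cases
    case zero
    then show ?thesis by (simp add: trie.simps patricia.simps)
  next
    case one
    then have "trie X = {[]}" "patricia X = {[]}" by (simp_all add: trie.simps patricia.simps)
    \<comment> \<open>A leaf has no child, so the non-unary clause applies and all its branches are
      empty.\<close>
    moreover have "contract {[]} = {[] :: 'a list}"
      by (subst contract_branching) (auto simp: root_children_def fringe_def)
    ultimately show ?thesis by simp
  next
    case many
    then have "X \<noteq> {}" by auto
    then have IH: "contract (fringe (trie X) [a]) = patricia (suffixes_at X [a])" for a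
      using many 1 by (simp add: fringe_trie finite_suffixes_at prefix_free_suffixes_at)
    have nil: "[] \<in> trie X" using many by simp
    have pat: "patricia X = {[]} \<union> (\<Union>a. (#) a ` patricia (suffixes_at X (lcp X @ [a])))"
      using many by (subst patricia.simps) simp
    show ?thesis
    proof (cases "\<exists>a. root_children (trie X) = {a}")
      case True
      then obtain a where a: "root_children (trie X) = {a}" by blast
      let ?Y = "suffixes_at X [a]"
      have X: "common_prefix X [a]"
        using a root_children_trie_singleton_iff[OF 1(3) many] by simp
      \<comment> \<open>\<open>?Y\<close> has as many strings as \<open>X\<close>, so the same
        clause applies, and \<open>a\<close> followed by \<open>lcp ?Y\<close> is
        \<open>lcp X\<close>.\<close>
      have "patricia ?Y = {[]} \<union> (\<Union>b. (#) b ` patricia (suffixes_at ?Y (lcp ?Y @ [b])))"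
        using many card_suffixes_at[OF X] by (subst patricia.simps) simp
      also have "\<dots> = patricia X"
        unfolding pat lcp_Cons[OF many X] suffixes_at_append by simp
      finally show ?thesis
        using contract_unary[OF finite_trie nil a] IH by simp
    next
      case False
      have "lcp X = []"
      proof (cases "lcp X")
        case (Cons a w)
        then have "common_prefix X [a]"
          using common_prefix_lcp[OF many] common_prefix_Cons by metis
        then show ?thesis
          using False root_children_trie_singleton_iff[OF 1(3) many] by blast
      qed
      moreover have "card (root_children (trie X)) \<noteq> 1"
        using False by (simp add: card_1_singleton_iff)
      ultimately show ?thesis
        using contract_branching[OF finite_trie nil] IH pat by simp
    qed
  qed
qed

section \<open>Sums over the nodes before and after contraction\<close>

section \<open>Pulling back the sum\<close>

lemma sum_contract:
  fixes \<phi> :: "'a::finite list set \<Rightarrow> 'b::comm_monoid_add"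
  assumes "finite T" "prefix_closed T"
  shows "(\<Sum>v\<in>contract T. \<phi> (fringe (contract T) v)) =
    (\<Sum>v\<in>T. if card (root_children (fringe T v)) = 1 then 0 else \<phi> (contract (fringe T v)))"
    (is "?L T = sum (?f T) T")
  using assms
proof (induction T rule: contract.induct)
  case (1 T)
  show ?case
  proof (cases "T = {}")
    case False
    then have nil: "[] \<in> T" using prefix_closed_Nil 1 by blast
    have prems: "finite (fringe T [a])" "prefix_closed (fringe T [a])" for a
      using 1 by (simp_all add: finite_fringe prefix_closed_fringe)
    \<comment> \<open>Each summand depends only on the subtree at its node, so a branch contributes
      the same sum as it does as a tree of its own.\<close>
    have f_Cons: "?f T (a # u) = ?f (fringe T [a]) u" for a u
      by (simp add: fringe_fringe)
    have split: "sum (?f T) T = ?f T [] + (\<Sum>a\<in>UNIV. sum (?f (fringe T [a])) (fringe T [a]))"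
      using sum_tree[OF 1(3) nil, of "?f T"] unfolding f_Cons .
    show ?thesis
    proof (cases "card (root_children T) = 1")
      case True
      then obtain a where a: "root_children T = {a}" by (auto simp: card_1_singleton_iff)
      \<comment> \<open>The induction hypothesis for the unary clause names the child by
        \<open>the_elem\<close>.\<close>
      then have el: "the_elem (root_children T) = a" by simp
      have "fringe T [b] = {}" if "b \<noteq> a" for b
        using that a prefix_closedD[OF 1(4), of "[b]"] by (auto simp: fringe_def root_children_def)
      \<comment> \<open>Only the branch of \<open>a\<close> is nonempty; with the zero toll at the
        root, its sum is the whole sum.\<close>
      then have "(\<Sum>b\<in>UNIV. sum (?f (fringe T [b])) (fringe T [b])) =
          (\<Sum>b\<in>{a}. sum (?f (fringe T [b])) (fringe T [b]))"
        by (intro sum.mono_neutral_right) auto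
      also have "\<dots> = ?L (fringe T [a])"
        using 1(1)[unfolded el, symmetric] prems nil True 1(3) by simp
      also have "\<dots> = ?L T"
        using contract_unary[OF 1(3) nil a] by simp
      finally show ?thesis using split True by simp
    next
      case False
      note C = contract_branching[OF 1(3) nil False]
      have nilC: "[] \<in> contract T"
        unfolding C by simp
      have frC: "fringe (contract T) [a] = contract (fringe T [a])" for a
        unfolding C by simp
      have frC2: "fringe (contract T) (a # u) = fringe (contract (fringe T [a])) u" for a u
        using fringe_fringe[of "contract T" "[a]" u] by (simp add: frC)
      \<comment> \<open>The root survives contraction, and the branches of the contraction are the
        contracted branches, so the sum splits in the same way on both sides.\<close>
      have "?L T = \<phi> (contract T) + (\<Sum>a\<in>UNIV. ?L (fringe T [a]))"
        using sum_tree[OF finite_contract, of T "\<lambda>v. \<phi> (fringe (contract T) v)"] nilC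
        by (simp add: frC frC2)
      also have "\<dots> = \<phi> (contract T) + (\<Sum>a\<in>UNIV. sum (?f (fringe T [a])) (fringe T [a]))"
        using 1(2) 1(3) nil False prems by simp
      finally show ?thesis using split False by simp
    qed
  qed simp
qed

theorem proposition1:
  fixes \<phi> \<Phi> :: "'a::finite list set \<Rightarrow> real ^ 'd"
  assumes "additive_functional_on patricia_tries \<phi> \<Phi>"
  shows "additive_functional_on tries
           (\<lambda>T. if card (root_children T) = 1 then 0 else \<phi> (pat T)) (\<Phi> \<circ> pat)"
  unfolding additive_functional_on_def
proof (intro conjI ballI)
  \<comment> \<open>This reduces the toll at the empty tree to \<open>\<phi> {}\<close>.\<close>
  have "pat {} = ({} :: 'a list set)"
    by (simp add: pat_eq_contract prefix_closed_def)
  then show "(if card (root_children ({} :: 'a list set)) = 1 then 0 else \<phi> (pat {})) = 0"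
    using assms by (simp add: additive_functional_on_def)
next
  fix T :: "'a list set" assume "T \<in> tries"
  then obtain X where X: "T = trie X" "finite X" "prefix_free X" by (auto simp: tries_def)
  have T: "finite T" "prefix_closed T"
    unfolding X(1) by (rule finite_trie, rule prefix_closed_trie)
  have "contract T \<in> patricia_tries"
    using contract_trie X by (auto simp: patricia_tries_def)
  then have "(\<Phi> \<circ> pat) T = (\<Sum>v\<in>contract T. \<phi> (fringe (contract T) v))"
    using assms pat_eq_contract[OF T] by (simp add: additive_functional_on_def)
  also have "\<dots> = (\<Sum>v\<in>T. if card (root_children (fringe T v)) = 1 then 0
      else \<phi> (contract (fringe T v)))"
    by (rule sum_contract[OF T])
  \<comment> \<open>Subtrees inherit finiteness and prefix-closedness, which is all that identifying
    \<open>pat\<close> with \<open>contract\<close> requires.\<close>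
  also have "\<dots> = (\<Sum>v\<in>T. if card (root_children (fringe T v)) = 1 then 0
      else \<phi> (pat (fringe T v)))"
    unfolding pat_eq_contract[OF finite_fringe[OF T(1)] prefix_closed_fringe[OF T(2)]] ..
  finally show "(\<Phi> \<circ> pat) T = (\<Sum>v\<in>T. if card (root_children (fringe T v)) = 1 then 0
      else \<phi> (pat (fringe T v)))" .
qed

end
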